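(* Let $N\ge 1$, let $J_{jk}\in\mathbb{R}$ ($1\le j<k\le N$) be arbitrary couplings, and let $\tau>0$. Let $n\ge 1$ and let $(A_0,\dots,A_{6n-1})$ be a sequence of pulses which is a concatenation of $2n$ consecutive three-pulse blocks, each of the form $(\pm y,\pm x,\pm x)$, where all $6n$ signs are arbitrary and independent (or, alternatively, a concatenation of $2n$ consecutive blocks each of the form $(\pm x,\pm y,\pm y)$). Then the zeroth-order and first-order average Hamiltonians of the interaction $D_z$ under this pulse sequence both vanish: $H_A^{(0)}=0$ and $H_A^{(1)}=0$.
   Context: Consider $N$ spins-1/2 on $(\mathbb{C}^2)^{\otimes N}$, with spin operators $S_x^j,S_y^j,S_z^j$ (half the Pauli matrices, acting on site $j$), $\vec S^j\cdot\vec S^k=\sum_{\alpha\in\{x,y,z\}} S_\alpha^jS_\alpha^k$, and collective operators $X=\sum_j S_x^j$, $Y=\sum_j S_y^j$. For $\alpha\in\{x,y,z\}$ the dipolar interaction along $\alpha$ is $$D_\alpha=\tfrac12\sum_{j<k}J_{jk}\left(3S_\alpha^jS_\alpha^k-\vec S^j\cdot\vec S^k\right).$$ The intrinsic Hamiltonian is $D_z$. A pulse $\pm x$ (resp. $\pm y$) is the instantaneous global $\pi/2$ rotation $U_{\pm x}=e^{\mp i(\pi/2)X}$ (resp. $U_{\pm y}=e^{\mp i(\pi/2)Y}$). A sequence $(A_0,\dots,A_{M-1})$ means: for each $m=0,\dots,M-1$, at time $m\tau$ the pulse $A_m$ is applied, followed by free evolution for time $\tau$; there are no control imperfections. The toggling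 frame Hamiltonian is piecewise constant: for $m\tau<t<(m+1)\tau$, $$H_{tog}(t)=U_c^\dagger D_z U_c,\qquad U_c=U_{A_m}U_{A_{m-1}}\cdots U_{A_0}.$$ The zeroth- and first-order average Hamiltonians are $$H_A^{(0)}=\frac1{M\tau}\int_0^{M\tau}H_{tog}(t)\,dt,\qquad H_A^{(1)}=-\frac{i}{2M\tau}\int_0^{M\tau}dt_1\int_0^{t_1}dt_2\,[H_{tog}(t_1),H_{tog}(t_2)].$$ *)

theory Defs
  imports "HOL-Analysis.Analysis"
begin

text \<open>
  The sites form a finite linearly ordered type \<open>'n\<close>, so the number of spins is \<open>CARD('n)\<close>.
  The space of \<open>CARD('n)\<close> spins-1/2 has the product basis indexed by \<open>'n \<Rightarrow> 2\<close>,
  where the index \<open>1 :: 2\<close> at a site is spin up and \<open>2 :: 2\<close> (which equals \<open>0\<close>) is spin down.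
  An operator is its matrix in this basis.
\<close>

type_synonym 'n operator = "complex ^ ('n \<Rightarrow> 2) ^ ('n \<Rightarrow> 2)"

definition cscale :: "complex \<Rightarrow> complex ^ 'm ^ 'm \<Rightarrow> complex ^ 'm ^ 'm::finite" (infixr "*\<^sub>C" 75) where
  "c *\<^sub>C A = map_matrix ((*) c) A"

datatype axis = X_axis | Y_axis | Z_axis

fun pauli :: "axis \<Rightarrow> complex ^ 2 ^ 2" where
  "pauli X_axis = vector [vector [0, 1], vector [1, 0]]"
| "pauli Y_axis = vector [vector [0, - \<i>], vector [\<i>, 0]]"
| "pauli Z_axis = vector [vector [1, 0], vector [0, - 1]]"

text \<open>The tensor product of one 2 by 2 matrix per site, in the product basis.\<close>

definition tensor :: "('n \<Rightarrow> complex ^ 2 ^ 2) \<Rightarrow> 'n::finite operator" where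
  "tensor A = (\<chi> s t. \<Prod>j\<in>UNIV. A j $ s j $ t j)"

definition spin :: "axis \<Rightarrow> 'n \<Rightarrow> 'n::finite operator" where
  "spin \<alpha> j = tensor (\<lambda>l. if l = j then (1 / 2) *\<^sub>R pauli \<alpha> else mat 1)"

definition collective :: "axis \<Rightarrow> 'n::finite operator" where
  "collective \<alpha> = (\<Sum>j\<in>UNIV. spin \<alpha> j)"

definition spin_dot :: "'n \<Rightarrow> 'n \<Rightarrow> 'n::finite operator" where
  "spin_dot j k = (\<Sum>\<alpha>\<in>{X_axis, Y_axis, Z_axis}. spin \<alpha> j ** spin \<alpha> k)"

definition dipolar :: "('n \<Rightarrow> 'n \<Rightarrow> real) \<Rightarrow> axis \<Rightarrow> 'n::{finite,linorder} operator" where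
  "dipolar J \<alpha> =
     (1 / 2) *\<^sub>R (\<Sum>(j, k)\<in>{(j, k). j < k}.
        J j k *\<^sub>R (3 *\<^sub>R (spin \<alpha> j ** spin \<alpha> k) - spin_dot j k))"

primrec mat_pow :: "complex ^ 'm ^ 'm \<Rightarrow> nat \<Rightarrow> complex ^ 'm ^ 'm::finite" where
  "mat_pow A 0 = mat 1"
| "mat_pow A (Suc k) = A ** mat_pow A k"

definition mat_exp :: "complex ^ 'm ^ 'm \<Rightarrow> complex ^ 'm ^ 'm::finite" where
  "mat_exp A = (\<Sum>k. (1 / fact k) *\<^sub>R mat_pow A k)"

definition adjoint_mat :: "complex ^ 'm ^ 'm \<Rightarrow> complex ^ 'm ^ 'm::finite" where
  "adjoint_mat A = map_matrix cnj (transpose A)"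

definition commutator :: "complex ^ 'm ^ 'm \<Rightarrow> complex ^ 'm ^ 'm \<Rightarrow> complex ^ 'm ^ 'm::finite" where
  "commutator A B = A ** B - B ** A"

datatype sign = Plus | Minus

fun sign_val :: "sign \<Rightarrow> complex" where
  "sign_val Plus = 1"
| "sign_val Minus = - 1"

datatype pulse = Pulse_x sign | Pulse_y sign

fun pulse_op :: "pulse \<Rightarrow> 'n::finite operator" where
  "pulse_op (Pulse_x s) = mat_exp ((- sign_val s * \<i> * (pi / 2)) *\<^sub>C collective X_axis)"
| "pulse_op (Pulse_y s) = mat_exp ((- sign_val s * \<i> * (pi / 2)) *\<^sub>C collective Y_axis)"

text \<open>\<open>control_op A m\<close> is the product of the pulses \<open>A ! m\<close>, ..., \<open>A ! 0\<close>, later pulses on the left.\<close>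

primrec control_op :: "pulse list \<Rightarrow> nat \<Rightarrow> 'n::finite operator" where
  "control_op A 0 = pulse_op (A ! 0)"
| "control_op A (Suc m) = pulse_op (A ! Suc m) ** control_op A m"

text \<open>
  On the open interval from \<open>m * \<tau>\<close> to \<open>(m + 1) * \<tau>\<close>, with \<open>m < length A\<close>, the index below is \<open>m\<close>.
  The values at the finitely many pulse times, including the final time \<open>length A * \<tau>\<close>,
  where the index is out of range, do not affect the integrals.
\<close>

definition H_tog :: "'n operator \<Rightarrow> real \<Rightarrow> pulse list \<Rightarrow> real \<Rightarrow> 'n::finite operator" where
  "H_tog H \<tau> A t =
     (let U = control_op A (nat \<lfloor>t / \<tau>\<rfloor>) in adjoint_mat U ** H ** U)"

definition avg_ham0 :: "'n operator \<Rightarrow> real \<Rightarrow> pulse list \<Rightarrow> 'n::finite operator" where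
  "avg_ham0 H \<tau> A =
     (let T = real (length A) * \<tau> in (1 / T) *\<^sub>R integral {0..T} (H_tog H \<tau> A))"

definition avg_ham1 :: "'n operator \<Rightarrow> real \<Rightarrow> pulse list \<Rightarrow> 'n::finite operator" where
  "avg_ham1 H \<tau> A =
     (let T = real (length A) * \<tau> in
       (- \<i> / (2 * T)) *\<^sub>C
         integral {0..T} (\<lambda>t1. integral {0..t1} (\<lambda>t2.
           commutator (H_tog H \<tau> A t1) (H_tog H \<tau> A t2))))"

definition yxx_block :: "pulse list \<Rightarrow> bool" where
  "yxx_block B \<longleftrightarrow> (\<exists>s1 s2 s3. B = [Pulse_y s1, Pulse_x s2, Pulse_x s3])"

definition xyy_block :: "pulse list \<Rightarrow> bool" where
  "xyy_block B \<longleftrightarrow> (\<exists>s1 s2 s3. B = [Pulse_x s1, Pulse_y s2, Pulse_y s3])"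

definition block_sequence :: "(pulse list \<Rightarrow> bool) \<Rightarrow> nat \<Rightarrow> pulse list \<Rightarrow> bool" where
  "block_sequence P r A \<longleftrightarrow> (\<exists>Bs. length Bs = r \<and> (\<forall>B\<in>set Bs. P B) \<and> A = concat Bs)"

end

theory Submission
  imports Defs
begin

text \<open>
  A \<open>\<pi>/2\<close> pulse is a tensor power of a single-site unitary which conjugates every Pauli matrix to plus
  or minus a Pauli matrix; the dipolar interaction is quadratic in the spins, so the signs drop out
  and a pulse about one axis just exchanges the interactions along the other two. Hence the
  toggling-frame Hamiltonian takes the values \<open>P, Q, P, R, Q, R\<close> periodically, where \<open>P, Q, R\<close> are the
  interactions along the three axes in some order and \<open>P + Q + R = 0\<close>. For a step function with
  values \<open>f m\<close>, the first-order term is proportional to the sum of the commutators of \<open>f m\<close> with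
  \<open>\<Sum>k<m. f k\<close>. Each half period is a palindrome, so contributes nothing by itself, and the
  sums \<open>2 P + Q\<close> and \<open>2 R + Q\<close> over the two halves are opposite, hence commute.
\<close>

text \<open>
  Restricted to scalars: on matrices the unrestricted rule would rewrite into the componentwise product.
\<close>

lemmas scaleR_complex = scaleR_conv_of_real[where 'a = complex]

section \<open>Entrywise matrix algebra\<close>

lemma cscale_nth [simp]: "(c *\<^sub>C A) $ i $ j = c * A $ i $ j"
  by (simp add: cscale_def map_matrix_def)

lemma adjoint_mat_nth [simp]: "adjoint_mat A $ i $ j = cnj (A $ j $ i)"
  by (simp add: adjoint_mat_def map_matrix_def transpose_def)

lemma matrix_mult_nth: "(A ** B) $ i $ j = (\<Sum>k\<in>UNIV. A $ i $ k * B $ k $ j)"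
  by (simp add: matrix_matrix_mult_def)

lemma matrix_scaleR_left:
  fixes A :: "'a::real_algebra_1 ^ 'k ^ 'm" and B :: "'a ^ 'p ^ 'k"
  shows "(r *\<^sub>R A) ** B = r *\<^sub>R (A ** B)"
  by (simp add: vec_eq_iff matrix_mult_nth scaleR_sum_right)

lemma matrix_scaleR_right:
  fixes A :: "'a::real_algebra_1 ^ 'k ^ 'm" and B :: "'a ^ 'p ^ 'k"
  shows "A ** (r *\<^sub>R B) = r *\<^sub>R (A ** B)"
  by (simp add: vec_eq_iff matrix_mult_nth scaleR_sum_right)

lemma matrix_add_rdistrib:
  fixes A :: "'a::semiring_1 ^ 'k ^ 'm" and C :: "'a ^ 'p ^ 'k"
  shows "(A + B) ** C = A ** C + B ** C"
  by (simp add: vec_eq_iff matrix_mult_nth distrib_right sum.distrib)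

lemma cscale_mult_left: "(c *\<^sub>C A) ** B = c *\<^sub>C (A ** B)"
  by (simp add: vec_eq_iff matrix_mult_nth sum_distrib_left mult.assoc)

lemma cscale_mult_right: "A ** (c *\<^sub>C B) = c *\<^sub>C (A ** B)"
  by (simp add: vec_eq_iff matrix_mult_nth sum_distrib_left mult.left_commute)

lemma adjoint_mat_mult: "adjoint_mat (A ** B) = adjoint_mat B ** adjoint_mat A"
  by (simp add: vec_eq_iff matrix_mult_nth mult.commute)

section \<open>Conjugation and the matrix exponential\<close>

text \<open>The outer factors are kept independent, so that the same rules serve a change to an
  eigenbasis that is not normalised and the unitary conjugation by a pulse.\<close>

definition conj_by :: "'a::semiring_1 ^ 'm ^ 'm \<Rightarrow> 'a ^ 'm ^ 'm \<Rightarrow> 'a ^ 'm ^ 'm \<Rightarrow> 'a ^ 'm ^ 'm::finite" where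
  "conj_by V A W = V ** A ** W"

lemma linear_conj_by:
  fixes V W :: "complex ^ 'm ^ 'm::finite"
  shows "linear (\<lambda>A. conj_by V A W)"
  by (rule linearI)
    (simp_all add: conj_by_def matrix_add_ldistrib matrix_add_rdistrib
      matrix_scaleR_left matrix_scaleR_right)

lemma conj_by_cscale: "conj_by V (c *\<^sub>C A) W = c *\<^sub>C conj_by V A W"
  by (simp add: conj_by_def cscale_mult_left cscale_mult_right)

lemma conj_by_mult:
  fixes V W :: "'a::semiring_1 ^ 'm ^ 'm::finite"
  assumes "W ** V = mat 1"
  shows "conj_by V A W ** conj_by V B W = conj_by V (A ** B) W"
proof -
  have "conj_by V A W ** conj_by V B W = V ** A ** (W ** V) ** B ** W"
    by (simp only: conj_by_def matrix_mul_assoc)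
  then show ?thesis
    by (simp add: assms conj_by_def matrix_mul_assoc)
qed

lemma mat_pow_conj_by:
  assumes "V ** W = mat 1" "W ** V = mat 1"
  shows "mat_pow (conj_by V A W) k = conj_by V (mat_pow A k) W"
  by (induction k) (simp_all add: assms conj_by_mult, simp add: conj_by_def assms)

text \<open>Conjugation is linear in finite dimension, hence continuous, and so passes through the
  series term by term. An infinite sum says something only once convergence is known, hence the
  \<open>sums\<close> assumption.\<close>

lemma mat_exp_conj_by_sums:
  assumes "V ** W = mat 1" "W ** V = mat 1"
    and "(\<lambda>k. (1 / fact k) *\<^sub>R mat_pow A k) sums E"
  shows "mat_exp (conj_by V A W) = conj_by V E W"
proof -
  have "bounded_linear (\<lambda>A. conj_by V A W)"
    using linear_conj_by linear_conv_bounded_linear by blast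
  from bounded_linear.sums[OF this assms(3)]
  have "(\<lambda>k. (1 / fact k) *\<^sub>R mat_pow (conj_by V A W) k) sums conj_by V E W"
    by (simp add: mat_pow_conj_by assms(1,2) linear_scale[OF linear_conj_by])
  then show ?thesis
    by (simp add: mat_exp_def sums_iff)
qed

definition diag_mat :: "('m \<Rightarrow> complex) \<Rightarrow> complex ^ 'm ^ 'm::finite" where
  "diag_mat d = (\<chi> i j. if i = j then d i else 0)"

lemma mat_pow_diag_mat: "mat_pow (diag_mat d) k = diag_mat (\<lambda>i. d i ^ k)"
proof (induction k)
  case 0
  show ?case by (simp add: vec_eq_iff diag_mat_def mat_def)
next
  case (Suc k)
  then show ?case
    by (auto simp: vec_eq_iff diag_mat_def matrix_mult_nth if_distrib[of "\<lambda>x. x * _"] cong: if_cong)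
qed

lemma sums_vecI:
  fixes f :: "nat \<Rightarrow> 'a::real_normed_vector ^ 'm"
  assumes "\<And>i. (\<lambda>k. f k $ i) sums (a $ i)"
  shows "f sums a"
  unfolding sums_def using assms
  by (intro vec_tendstoI) (simp add: sums_def)

lemma mat_exp_diag_mat_sums:
  "(\<lambda>k. (1 / fact k) *\<^sub>R mat_pow (diag_mat d) k) sums diag_mat (\<lambda>i. exp (d i))"
proof (intro sums_vecI)
  fix i j
  show "(\<lambda>k. ((1 / fact k) *\<^sub>R mat_pow (diag_mat d) k) $ i $ j) sums (diag_mat (\<lambda>i. exp (d i)) $ i $ j)"
    unfolding mat_pow_diag_mat using exp_converges[of "d i"]
    by (auto simp: diag_mat_def divide_inverse scaleR_complex)
qed

section \<open>Tensor products and single-site operators\<close>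

text \<open>The inner index \<open>u\<close> runs over all functions from sites to basis states, so
  distributivity turns the sum of products over \<open>u\<close> into a product of one sum per
  site.\<close>

lemma tensor_mult: "tensor A ** tensor B = tensor (\<lambda>j. A j ** B j)"
proof -
  have "(\<Sum>u\<in>UNIV. (\<Prod>j\<in>UNIV. A j $ s j $ u j) * (\<Prod>j\<in>UNIV. B j $ u j $ t j)) =
        (\<Prod>j\<in>UNIV. \<Sum>b\<in>UNIV. A j $ s j $ b * B j $ b $ t j)" for s t
    using prod_sum_PiE[of "UNIV :: 'a set" "\<lambda>_. UNIV" "\<lambda>j b. A j $ s j $ b * B j $ b $ t j"]
    by (simp add: prod.distrib)
  then show ?thesis
    by (simp add: vec_eq_iff tensor_def matrix_mult_nth)
qed

lemma adjoint_mat_tensor: "adjoint_mat (tensor A) = tensor (\<lambda>j. adjoint_mat (A j))"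
  by (simp add: vec_eq_iff tensor_def)

lemma tensor_diag_mat:
  "tensor (\<lambda>j. diag_mat (d j)) = diag_mat (\<lambda>s. \<Prod>j\<in>UNIV. d j (s j))"
proof -
  \<comment> \<open>Distinct \<open>s\<close> and \<open>t\<close> differ at some site, and the
    factor of that site vanishes.\<close>
  have "(\<Prod>j\<in>UNIV. diag_mat (d j) $ s j $ t j) = 0" if "s \<noteq> t" for s t
    using that by (auto simp: diag_mat_def fun_eq_iff)
  then show ?thesis
    by (auto simp: vec_eq_iff tensor_def diag_mat_def)
qed

lemma mat_1_eq_diag_mat: "mat 1 = diag_mat (\<lambda>_. 1)"
  by (simp add: vec_eq_iff mat_def diag_mat_def)

lemma tensor_mat_1: "tensor (\<lambda>_. mat 1) = mat 1"
  by (simp add: mat_1_eq_diag_mat tensor_diag_mat)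

definition site_op :: "'n \<Rightarrow> complex ^ 2 ^ 2 \<Rightarrow> 'n::finite operator" where
  "site_op j B = tensor (\<lambda>l. if l = j then B else mat 1)"

lemma site_op_scaleR: "site_op j (r *\<^sub>R B) = r *\<^sub>R site_op j B"
proof -
  have "(\<Prod>l\<in>UNIV. (if l = j then r *\<^sub>R B else mat 1) $ s l $ t l) =
        r *\<^sub>R (\<Prod>l\<in>UNIV. (if l = j then B else mat 1) $ s l $ t l)" for s t
    by (simp add: prod.remove[of UNIV j])
  then show ?thesis
    by (simp add: vec_eq_iff site_op_def tensor_def)
qed

lemma spin_eq_site_op: "spin \<alpha> j = (1 / 2) *\<^sub>R site_op j (pauli \<alpha>)"
  unfolding site_op_scaleR[symmetric] by (simp add: spin_def site_op_def)

text \<open>At every site other than \<open>j\<close> the identity becomes \<open>v ** w\<close>,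
  which is again the identity.\<close>

lemma conj_by_tensor_site_op:
  assumes "v ** w = mat 1"
  shows "conj_by (tensor (\<lambda>_. v)) (site_op j B) (tensor (\<lambda>_. w)) = site_op j (conj_by v B w)"
proof -
  have "(\<lambda>l. v ** (if l = j then B else mat 1) ** w) = (\<lambda>l. if l = j then v ** B ** w else mat 1)"
    using assms by auto
  then show ?thesis
    by (simp add: conj_by_def site_op_def tensor_mult)
qed

section \<open>The exponential of a collective spin\<close>

lemmas mat2_simps =
  vec_eq_iff forall_2 matrix_mult_nth sum_2 mat_def vector_2 conj_by_def diag_mat_def

text \<open>The columns of \<open>v\<close> are eigenvectors for the eigenvalues 1 and -1, in this
  order. Leaving them unnormalised avoids square roots; \<open>w\<close> is the inverse of
  \<open>v\<close>.\<close>

lemma pauli_diagonalizable: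
  obtains v w :: "complex ^ 2 ^ 2"
  where "v ** w = mat 1" "w ** v = mat 1" "conj_by v (pauli Z_axis) w = pauli \<alpha>"
proof (cases \<alpha>)
  case X_axis
  show ?thesis
    by (rule that[of "vector [vector [1, 1], vector [1, - 1]]"
          "vector [vector [1 / 2, 1 / 2], vector [1 / 2, - 1 / 2]]"])
      (simp_all add: mat2_simps X_axis)
next
  case Y_axis
  show ?thesis
    by (rule that[of "vector [vector [1, 1], vector [\<i>, - \<i>]]"
          "vector [vector [1 / 2, - \<i> / 2], vector [1 / 2, \<i> / 2]]"])
      (simp_all add: mat2_simps Y_axis)
next
  case Z_axis
  show ?thesis
    by (rule that[of "mat 1" "mat 1"]) (simp_all add: Z_axis conj_by_def)
qed

lemma collective_Z_eq_diag_mat: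
  "collective Z_axis = diag_mat (\<lambda>s. \<Sum>j\<in>UNIV. (1 / 2) * pauli Z_axis $ s j $ s j)"
proof -
  have "site_op j (pauli Z_axis) = diag_mat (\<lambda>s. pauli Z_axis $ s j $ s j)" for j :: 'a
  proof -
    have "pauli Z_axis = diag_mat (\<lambda>b. pauli Z_axis $ b $ b)"
      by (simp add: mat2_simps)
    then have "(\<lambda>l. if l = j then pauli Z_axis else mat 1) =
      (\<lambda>l. diag_mat (\<lambda>b. if l = j then pauli Z_axis $ b $ b else 1))"
      by (auto simp: mat_1_eq_diag_mat)
    then show ?thesis
      by (simp add: site_op_def tensor_diag_mat del: pauli.simps)
  qed
  then show ?thesis
    by (auto simp: collective_def spin_eq_site_op vec_eq_iff diag_mat_def scaleR_complex
        simp del: pauli.simps)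
qed

text \<open>In the eigenbasis of the spins the exponent is a sum over the sites, so its exponential
  is a product over the sites, that is, a tensor power. The single-site factor is cosh plus sinh
  times a Pauli matrix, because the eigenvalues are 1 and -1.\<close>

lemma mat_exp_collective:
  "mat_exp (c *\<^sub>C collective \<alpha>) =
     tensor (\<lambda>_. cosh (c / 2) *\<^sub>C mat 1 + sinh (c / 2) *\<^sub>C pauli \<alpha>)"
proof -
  obtain v w where vw: "v ** w = mat 1" "w ** v = mat 1" "conj_by v (pauli Z_axis) w = pauli \<alpha>"
    by (rule pauli_diagonalizable)
  define V W :: "'a operator" where "V = tensor (\<lambda>_. v)" and "W = tensor (\<lambda>_. w)"
  have VW: "V ** W = mat 1" "W ** V = mat 1"
    by (simp_all add: V_def W_def tensor_mult vw tensor_mat_1)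
  have "conj_by V (spin Z_axis j) W = spin \<alpha> j" for j
    by (simp add: spin_eq_site_op linear_scale[OF linear_conj_by] V_def W_def
        conj_by_tensor_site_op vw del: pauli.simps)
  \<comment> \<open>The same change of basis at every site diagonalises all the spins at
    once.\<close>
  then have coll: "c *\<^sub>C collective \<alpha> = conj_by V (c *\<^sub>C collective Z_axis) W"
    by (simp add: conj_by_cscale collective_def linear_sum[OF linear_conj_by])
  define z where "z b = pauli Z_axis $ b $ b" for b
  define D where "D = diag_mat (\<lambda>b. exp (c / 2 * z b))"
  have D: "D = cosh (c / 2) *\<^sub>C mat 1 + sinh (c / 2) *\<^sub>C pauli Z_axis"
    by (simp add: D_def z_def mat2_simps cosh_plus_sinh cosh_minus_sinh)
  have Z: "c *\<^sub>C collective Z_axis = diag_mat (\<lambda>s::'a \<Rightarrow> 2. \<Sum>j\<in>UNIV. c / 2 * z (s j))"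
    by (simp add: collective_Z_eq_diag_mat vec_eq_iff diag_mat_def sum_distrib_left z_def
        del: pauli.simps)
  have "mat_exp (c *\<^sub>C collective \<alpha>) =
      conj_by V (diag_mat (\<lambda>s. exp (\<Sum>j\<in>UNIV. c / 2 * z (s j)))) W"
    unfolding coll Z by (rule mat_exp_conj_by_sums[OF VW mat_exp_diag_mat_sums])
  also have "\<dots> = conj_by V (tensor (\<lambda>_. D)) W"
    by (simp add: D_def tensor_diag_mat exp_sum)
  also have "\<dots> = tensor (\<lambda>_. conj_by v D w)"
    by (simp add: V_def W_def conj_by_def tensor_mult)
  also have "conj_by v D w = cosh (c / 2) *\<^sub>C mat 1 + sinh (c / 2) *\<^sub>C pauli \<alpha>"
    by (simp add: D linear_add[OF linear_conj_by] conj_by_cscale vw del: pauli.simps)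
      (simp add: conj_by_def vw)
  finally show ?thesis .
qed

section \<open>Pulses and their action on the dipolar interactions\<close>

fun pulse_axis :: "pulse \<Rightarrow> axis" where
  "pulse_axis (Pulse_x _) = X_axis"
| "pulse_axis (Pulse_y _) = Y_axis"

fun pulse_sign :: "pulse \<Rightarrow> sign" where
  "pulse_sign (Pulse_x s) = s"
| "pulse_sign (Pulse_y s) = s"

text \<open>The exponential of -i s (pi/4) times the Pauli matrix of the axis, with s the sign of
  the pulse; the common value of the cosine and sine of pi/4 is pulled out.\<close>

definition rotor :: "pulse \<Rightarrow> complex ^ 2 ^ 2" where
  "rotor p = (sqrt 2 / 2) *\<^sub>R
     (mat 1 + (- sign_val (pulse_sign p) * \<i>) *\<^sub>C pauli (pulse_axis p))"

lemma pulse_op_eq_tensor: "pulse_op p = tensor (\<lambda>_. rotor p)"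
proof -
  let ?s = "sign_val (pulse_sign p)"
  let ?c = "- ?s * \<i> * (pi / 2)"
  have "exp (\<i> * pi / 4) = sqrt 2 / 2 + \<i> * (sqrt 2 / 2)"
       "exp (- (\<i> * pi / 4)) = sqrt 2 / 2 - \<i> * (sqrt 2 / 2)"
    using cis_conv_exp[of "pi/4"] cis_conv_exp[of "-pi/4"]
    by (simp_all add: complex_eq_iff cos_45 sin_45)
  then have E: "cosh (\<i> * pi / 4) = sqrt 2 / 2" "sinh (\<i> * pi / 4) = \<i> * (sqrt 2 / 2)"
    by (simp_all add: cosh_def sinh_def scaleR_complex)
  \<comment> \<open>A positive pulse has exponent -i pi/4. As cosh is even and sinh is odd, their
    values at i pi/4 settle both signs.\<close>
  consider "?c / 2 = \<i> * pi / 4" "?s = - 1" | "?c / 2 = - (\<i> * pi / 4)" "?s = 1"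
    by (cases "pulse_sign p") auto
  then have CS: "cosh (?c / 2) = sqrt 2 / 2 \<and> sinh (?c / 2) = sqrt 2 / 2 * (- ?s * \<i>)"
    by cases (simp_all only: E cosh_minus sinh_minus, simp_all)
  have "rotor p = cosh (?c / 2) *\<^sub>C mat 1 + sinh (?c / 2) *\<^sub>C pauli (pulse_axis p)"
    by (simp only: CS) (simp add: rotor_def vec_eq_iff scaleR_complex algebra_simps del: pauli.simps)
  moreover have "pulse_op p = mat_exp (?c *\<^sub>C collective (pulse_axis p))"
    by (cases p) simp_all
  ultimately show ?thesis
    by (simp only: mat_exp_collective)
qed

text \<open>A quarter turn permutes the axes up to sign. Only the permutation is recorded, since the
  signs square to one in a product of two spins.\<close>

fun axis_swap :: "pulse \<Rightarrow> axis \<Rightarrow> axis" where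
  "axis_swap (Pulse_x _) X_axis = X_axis"
| "axis_swap (Pulse_x _) Y_axis = Z_axis"
| "axis_swap (Pulse_x _) Z_axis = Y_axis"
| "axis_swap (Pulse_y _) X_axis = Z_axis"
| "axis_swap (Pulse_y _) Y_axis = Y_axis"
| "axis_swap (Pulse_y _) Z_axis = X_axis"

lemma complex_sqrt_2_squared: "complex_of_real (sqrt 2) * complex_of_real (sqrt 2) = 2"
  by (metis of_real_mult of_real_numeral real_sqrt_mult_self abs_numeral)

lemma rotor_unitary:
  "rotor p ** adjoint_mat (rotor p) = mat 1" "adjoint_mat (rotor p) ** rotor p = mat 1"
  by (cases p; cases "pulse_sign p";
      simp add: rotor_def mat2_simps scaleR_complex complex_sqrt_2_squared algebra_simps)+

text \<open>A finite check over pulses and axes. The sign is packaged as a real \<open>e\<close> of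
  square one, the form in which it cancels later.\<close>

lemma rotor_conj_pauli:
  obtains e :: real where "e * e = 1"
    "conj_by (adjoint_mat (rotor p)) (pauli \<alpha>) (rotor p) = e *\<^sub>R pauli (axis_swap p \<alpha>)"
proof -
  have "conj_by (adjoint_mat (rotor p)) (pauli \<alpha>) (rotor p) = pauli (axis_swap p \<alpha>) \<or>
        conj_by (adjoint_mat (rotor p)) (pauli \<alpha>) (rotor p) = - pauli (axis_swap p \<alpha>)"
    by (cases p; cases "pulse_sign p"; cases \<alpha>;
      simp add: rotor_def mat2_simps scaleR_complex complex_sqrt_2_squared algebra_simps)
  then show ?thesis
    using that[of 1] that[of "-1"] by auto
qed

lemma pulse_op_unitary: "pulse_op p ** adjoint_mat (pulse_op p) = mat 1"
  by (simp add: pulse_op_eq_tensor adjoint_mat_tensor tensor_mult rotor_unitary tensor_mat_1)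

text \<open>The conjugation splits over the product, and both sites pick up the same sign
  \<open>e\<close> because all sites are rotated alike.\<close>

lemma conj_pulse_op_spin_spin:
  "conj_by (adjoint_mat (pulse_op p)) (spin \<alpha> j ** spin \<alpha> k) (pulse_op p) =
     spin (axis_swap p \<alpha>) j ** spin (axis_swap p \<alpha>) k"
proof -
  obtain e :: real where e: "e * e = 1"
    "conj_by (adjoint_mat (rotor p)) (pauli \<alpha>) (rotor p) = e *\<^sub>R pauli (axis_swap p \<alpha>)"
    by (rule rotor_conj_pauli)
  have "conj_by (adjoint_mat (pulse_op p)) (spin \<alpha> l) (pulse_op p) =
      e *\<^sub>R spin (axis_swap p \<alpha>) l" for l :: 'a
    by (simp add: pulse_op_eq_tensor adjoint_mat_tensor spin_eq_site_op
        linear_scale[OF linear_conj_by] conj_by_tensor_site_op rotor_unitary e site_op_scaleR)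
  then show ?thesis
    by (simp add: conj_by_mult[OF pulse_op_unitary, symmetric] matrix_scaleR_left
        matrix_scaleR_right e(1))
qed

lemma conj_pulse_op_dipolar:
  "conj_by (adjoint_mat (pulse_op p)) (dipolar J \<alpha>) (pulse_op p) = dipolar J (axis_swap p \<alpha>)"
proof -
  \<comment> \<open>The scalar product is rotation invariant: its three summands are merely
    permuted.\<close>
  have "conj_by (adjoint_mat (pulse_op p)) (spin_dot j k) (pulse_op p) = spin_dot j k"
    for j k :: 'a
    by (cases p) (simp_all add: spin_dot_def linear_add[OF linear_conj_by] conj_pulse_op_spin_spin
        del: pulse_op.simps)
  then show ?thesis
    by (simp add: dipolar_def linear_scale[OF linear_conj_by] linear_sum[OF linear_conj_by]
        linear_diff[OF linear_conj_by] conj_pulse_op_spin_spin case_prod_beta)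
qed

text \<open>For each pair of sites the three terms
  \<open>3 *\<^sub>R (spin \<alpha> j ** spin \<alpha> k)\<close> add up to three times the scalar
  product, which is what is subtracted.\<close>

lemma sum_dipolar: "dipolar J X_axis + dipolar J Y_axis + dipolar J Z_axis = 0"
proof -
  let ?h = "\<lambda>\<alpha> (j, k). 3 *\<^sub>R (spin \<alpha> j ** spin \<alpha> k) - spin_dot j k"
  have h: "?h X_axis jk + ?h Y_axis jk + ?h Z_axis jk = 0" for jk :: "'a \<times> 'a"
    by (cases jk) (simp add: spin_dot_def vec_eq_iff scaleR_complex)
  define S :: "('a \<times> 'a) set" where "S = {(j, k). j < k}"
  have "dipolar J \<alpha> = (1 / 2) *\<^sub>R (\<Sum>jk\<in>S. J (fst jk) (snd jk) *\<^sub>R ?h \<alpha> jk)" for \<alpha>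
    by (simp add: dipolar_def S_def[symmetric] case_prod_beta)
  then show ?thesis
    by (simp only: sum.distrib[symmetric] scaleR_add_right[symmetric] h) simp
qed

text \<open>The axis is acted on by the last pulse first, since that pulse is innermost in \<open>U\<^sup>\<dagger> D U\<close>.\<close>

primrec toggled_axis :: "pulse list \<Rightarrow> nat \<Rightarrow> axis \<Rightarrow> axis" where
  "toggled_axis A 0 \<alpha> = axis_swap (A ! 0) \<alpha>"
| "toggled_axis A (Suc m) \<alpha> = toggled_axis A m (axis_swap (A ! Suc m) \<alpha>)"

lemma conj_control_op_dipolar:
  "conj_by (adjoint_mat (control_op A m)) (dipolar J \<alpha>) (control_op A m) =
     dipolar J (toggled_axis A m \<alpha>)"
\<comment> \<open>The axis is general because the last pulse changes it before the earlier ones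
  act.\<close>
proof (induction m arbitrary: \<alpha>)
  case 0
  then show ?case by (simp add: conj_pulse_op_dipolar)
next
  case (Suc m)
  have "conj_by (adjoint_mat (control_op A (Suc m))) (dipolar J \<alpha>) (control_op A (Suc m)) =
    conj_by (adjoint_mat (control_op A m))
      (conj_by (adjoint_mat (pulse_op (A ! Suc m))) (dipolar J \<alpha>) (pulse_op (A ! Suc m)))
      (control_op A m)"
    by (simp add: conj_by_def adjoint_mat_mult matrix_mul_assoc)
  with Suc show ?case
    by (simp add: conj_pulse_op_dipolar)
qed

lemma H_tog_dipolar:
  "H_tog (dipolar J \<alpha>) \<tau> A t = dipolar J (toggled_axis A (nat \<lfloor>t / \<tau>\<rfloor>) \<alpha>)"
  unfolding conj_control_op_dipolar[symmetric] by (simp add: H_tog_def conj_by_def Let_def)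

section \<open>Integrals of step functions and their commutators\<close>

text \<open>The values of \<open>F\<close> at the jumps are left open, since finitely many points do
  not affect the integral. Closed bounds on \<open>t\<close> let the induction hypothesis be used at
  the right end of a step.\<close>

lemma step_has_integral:
  fixes f :: "nat \<Rightarrow> 'a::euclidean_space"
  assumes "\<tau> > 0" and F: "\<And>k t. real k * \<tau> < t \<Longrightarrow> t < real (Suc k) * \<tau> \<Longrightarrow> F t = f k"
    and "real m * \<tau> \<le> t" "t \<le> real (Suc m) * \<tau>"
  shows "(F has_integral (\<tau> *\<^sub>R (\<Sum>k<m. f k) + (t - real m * \<tau>) *\<^sub>R f m)) {0..t}"
  using assms(3,4)
proof (induction m arbitrary: t)
  case (0 t)
  have "((\<lambda>_. f 0) has_integral (t - 0) *\<^sub>R f 0) {0..t}"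
    using 0 has_integral_const_real[of "f 0" 0 t] by simp
  then have "(F has_integral (t - 0) *\<^sub>R f 0) {0..t}"
    by (rule has_integral_spike_finite[of "{0, t}", rotated 2]) (use F[of 0] 0 in auto)
  then show ?case by simp
next
  case (Suc m)
  let ?t = "real (Suc m) * \<tau>"
  have "((\<lambda>_. f (Suc m)) has_integral (t - ?t) *\<^sub>R f (Suc m)) {?t..t}"
    using Suc.prems has_integral_const_real[of "f (Suc m)" ?t t] by simp
  then have 1: "(F has_integral (t - ?t) *\<^sub>R f (Suc m)) {?t..t}"
    by (rule has_integral_spike_finite[of "{?t, t}", rotated 2]) (use F[of _ "Suc m"] F Suc.prems in auto)
  have "(F has_integral (\<tau> *\<^sub>R (\<Sum>k<m. f k) + (?t - real m * \<tau>) *\<^sub>R f m)) {0..?t}"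
    using \<open>\<tau> > 0\<close> by (intro Suc.IH) (auto simp: algebra_simps)
  from has_integral_combine[OF _ _ this 1] Suc.prems \<open>\<tau> > 0\<close>
  show ?case by (simp add: algebra_simps)
qed

lemma step_integral:
  fixes f :: "nat \<Rightarrow> 'a::euclidean_space"
  assumes "\<tau> > 0" "\<And>k t. real k * \<tau> < t \<Longrightarrow> t < real (Suc k) * \<tau> \<Longrightarrow> F t = f k"
  shows "integral {0..real m * \<tau>} F = \<tau> *\<^sub>R (\<Sum>k<m. f k)"
  using step_has_integral[where t = "real m * \<tau>" and F = F and f = f and m = m and \<tau> = \<tau>] assms
  by (auto simp: algebra_simps intro: integral_unique)

lemma linear_commutator: "linear (commutator A)"
  by (rule linearI)
    (simp_all add: commutator_def matrix_add_ldistrib matrix_add_rdistrib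
      matrix_scaleR_left matrix_scaleR_right scaleR_diff_right)

lemma commutator_self [simp]: "commutator A A = 0"
  by (simp add: commutator_def)

lemma nat_floor_divide:
  assumes "\<tau> > 0" "real k * \<tau> < t" "t < real (Suc k) * \<tau>"
  shows "nat \<lfloor>t / \<tau>\<rfloor> = k"
proof -
  have "\<lfloor>t / \<tau>\<rfloor> = int k"
    using assms by (intro floor_unique) (auto simp: field_simps)
  then show ?thesis by simp
qed

text \<open>The unfinished current step contributes a multiple of the commutator of
  \<open>f m\<close> with itself, hence nothing. So the value does not depend on \<open>t\<close>
  within the step, and the outer integrand is again a step function.\<close>

lemma inner_integral_commutator:
  fixes f :: "nat \<Rightarrow> complex ^ 'm ^ 'm"
  assumes "\<tau> > 0" "real m * \<tau> < t" "t < real (Suc m) * \<tau>"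
  shows "integral {0..t} (\<lambda>t'. commutator (f m) (f (nat \<lfloor>t' / \<tau>\<rfloor>))) =
     \<tau> *\<^sub>R commutator (f m) (\<Sum>k<m. f k)"
proof -
  have bl: "bounded_linear (commutator (f m))"
    using linear_commutator linear_conv_bounded_linear by blast
  have "((\<lambda>t'. f (nat \<lfloor>t' / \<tau>\<rfloor>)) has_integral
      (\<tau> *\<^sub>R (\<Sum>k<m. f k) + (t - real m * \<tau>) *\<^sub>R f m)) {0..t}"
    using assms by (intro step_has_integral) (auto simp: nat_floor_divide)
  from has_integral_linear[OF this bl] show ?thesis
    by (intro integral_unique)
      (simp add: o_def linear_add[OF linear_commutator] linear_scale[OF linear_commutator])
qed

section \<open>The cancellation over one period\<close>

text \<open>Both sums are carried through one induction: a vanishing sum over the earlier periods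
  removes all commutators between different periods, so only those within one period remain.\<close>

lemma period_six_sums:
  fixes f :: "nat \<Rightarrow> complex ^ 'm ^ 'm"
  assumes "P + Q + R = 0"
    and "\<And>k. k < n \<Longrightarrow> f (6 * k) = P \<and> f (6 * k + 1) = Q \<and> f (6 * k + 2) = P \<and>
      f (6 * k + 3) = R \<and> f (6 * k + 4) = Q \<and> f (6 * k + 5) = R"
  shows "(\<Sum>k<6 * n. f k) = 0 \<and> (\<Sum>m<6 * n. commutator (f m) (\<Sum>k<m. f k)) = 0"
  using assms(2)
proof (induction n)
  case 0
  then show ?case by simp
next
  case (Suc n)
  \<comment> \<open>Eliminating \<open>R\<close> leaves an identity in two noncommuting matrices
    \<open>P\<close> and \<open>Q\<close>.\<close>
  have R: "R = - P - Q"
    using assms(1) by (metis add_eq_0_iff diff_conv_add_uminus minus_add_distrib)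
  have IH: "(\<Sum>k<6 * n. f k) = 0" "(\<Sum>m<6 * n. commutator (f m) (\<Sum>k<m. f k)) = 0"
    using Suc by auto
  have six: "6 * Suc n = Suc (Suc (Suc (Suc (Suc (Suc (6 * n))))))"
    by simp
  have f: "f (6 * n) = P" "f (Suc (6 * n)) = Q" "f (Suc (Suc (6 * n))) = P"
    "f (Suc (Suc (Suc (6 * n)))) = R" "f (Suc (Suc (Suc (Suc (6 * n))))) = Q"
    "f (Suc (Suc (Suc (Suc (Suc (6 * n)))))) = R"
    using Suc.prems[of n] by (simp_all add: numeral_eq_Suc)
  show ?case
    unfolding six sum.lessThan_Suc f IH
    by (simp add: R linear_add[OF linear_commutator] linear_diff[OF linear_commutator]
      linear_neg[OF linear_commutator] linear_0[OF linear_commutator])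
      (simp add: commutator_def vec_eq_iff matrix_mult_nth algebra_simps sum.distrib
        sum_distrib_left sum_negf sum_subtractf)
qed

text \<open>With involutions \<open>p\<close> and \<open>q\<close>, a block composes to p q q = p
  and two blocks to the identity, hence period six.\<close>

lemma toggled_axis_periodic:
  assumes "\<And>k. k < 2 * n \<Longrightarrow> axis_swap (A ! (3 * k)) = p \<and>
      axis_swap (A ! (3 * k + 1)) = q \<and> axis_swap (A ! (3 * k + 2)) = q"
    and "\<And>\<alpha>. p (p \<alpha>) = \<alpha>" "\<And>\<alpha>. q (q \<alpha>) = \<alpha>"
    and "k < n"
  shows "toggled_axis A (6 * k) \<alpha> = p \<alpha> \<and> toggled_axis A (6 * k + 1) \<alpha> = p (q \<alpha>) \<and>
    toggled_axis A (6 * k + 2) \<alpha> = p \<alpha> \<and> toggled_axis A (6 * k + 3) \<alpha> = \<alpha> \<and>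
    toggled_axis A (6 * k + 4) \<alpha> = q \<alpha> \<and> toggled_axis A (6 * k + 5) \<alpha> = \<alpha>"
proof -
  have swap: "axis_swap (A ! (6 * k)) = p" "axis_swap (A ! (6 * k + 1)) = q"
      "axis_swap (A ! (6 * k + 2)) = q" "axis_swap (A ! (6 * k + 3)) = p"
      "axis_swap (A ! (6 * k + 4)) = q" "axis_swap (A ! (6 * k + 5)) = q" if "k < n" for k
  proof -
    have e: "3 * (2 * k) = 6 * k" "3 * (2 * k + 1) = 6 * k + 3"
        "6 * k + 3 + 1 = 6 * k + 4" "6 * k + 3 + 2 = 6 * k + 5"
      by simp_all
    show "axis_swap (A ! (6 * k)) = p" "axis_swap (A ! (6 * k + 1)) = q"
      "axis_swap (A ! (6 * k + 2)) = q" "axis_swap (A ! (6 * k + 3)) = p"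
      "axis_swap (A ! (6 * k + 4)) = q" "axis_swap (A ! (6 * k + 5)) = q"
      using assms(1)[of "2 * k", unfolded e] assms(1)[of "2 * k + 1", unfolded e] that
      by simp_all
  qed
  \<comment> \<open>Within a period everything follows from its first value. The identity at
    \<open>6 * k + 5\<close> then starts the next period, which drives the induction below.\<close>
  have rest: "toggled_axis A (6 * k + 1) \<alpha> = p (q \<alpha>) \<and>
      toggled_axis A (6 * k + 2) \<alpha> = p \<alpha> \<and> toggled_axis A (6 * k + 3) \<alpha> = \<alpha> \<and>
      toggled_axis A (6 * k + 4) \<alpha> = q \<alpha> \<and> toggled_axis A (6 * k + 5) \<alpha> = \<alpha>"
    if "k < n" "\<And>\<alpha>. toggled_axis A (6 * k) \<alpha> = p \<alpha>" for k \<alpha>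
    using swap[OF that(1)] that(2) assms(2,3) by (simp add: numeral_eq_Suc)
  have "toggled_axis A (6 * k) \<alpha> = p \<alpha>" for \<alpha>
    using \<open>k < n\<close>
  proof (induction k arbitrary: \<alpha>)
    case 0
    then show ?case using swap[of 0] by simp
  next
    case (Suc k)
    then have "k < n" by simp
    have "6 * Suc k = Suc (6 * k + 5)" by simp
    then have "toggled_axis A (6 * Suc k) \<alpha> =
        toggled_axis A (6 * k + 5) (axis_swap (A ! (6 * Suc k)) \<alpha>)"
      by (simp only: toggled_axis.simps)
    also have "\<dots> = p \<alpha>"
      using rest[OF \<open>k < n\<close> Suc.IH[OF \<open>k < n\<close>]] swap(1)[OF Suc.prems] by simp
    finally show ?case .
  qed
  with rest \<open>k < n\<close> show ?thesis by blast
qed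

section \<open>Block sequences of pulses\<close>

lemma nth_concat_uniform:
  assumes "\<forall>B\<in>set Bs. length B = l" "k < length Bs" "i < l"
  shows "concat Bs ! (l * k + i) = Bs ! k ! i"
  using assms
proof (induction Bs arbitrary: k)
  case (Cons B Bs)
  then show ?case by (cases k) (auto simp: nth_append)
qed simp

lemma length_concat_uniform:
  assumes "\<forall>B\<in>set Bs. length B = l"
  shows "length (concat Bs) = l * length Bs"
  using assms by (induction Bs) auto

lemma block_sequence_nth:
  assumes "block_sequence P r A" "\<And>B. P B \<Longrightarrow> length B = 3"
  shows "length A = 3 * r"
    and "k < r \<Longrightarrow> \<exists>B. P B \<and> A ! (3 * k) = B ! 0 \<and> A ! (3 * k + 1) = B ! 1 \<and> A ! (3 * k + 2) = B ! 2"
proof -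
  obtain Bs where Bs: "length Bs = r" "\<forall>B\<in>set Bs. P B" "A = concat Bs"
    using assms(1) by (auto simp: block_sequence_def)
  then have l: "\<forall>B\<in>set Bs. length B = 3"
    using assms(2) by blast
  show "length A = 3 * r"
    using length_concat_uniform[OF l] Bs by simp
  show "\<exists>B. P B \<and> A ! (3 * k) = B ! 0 \<and> A ! (3 * k + 1) = B ! 1 \<and> A ! (3 * k + 2) = B ! 2"
    if "k < r"
    using that Bs nth_concat_uniform[OF l, of k 0] nth_concat_uniform[OF l, of k 1]
      nth_concat_uniform[OF l, of k 2]
    by (intro exI[of _ "Bs ! k"]) auto
qed

text \<open>Normalising the sign to \<open>Plus\<close> reduces all choices of signs to one fixed
  pair of involutions.\<close>

lemma axis_swap_eq:
  "axis_swap (Pulse_x s) = axis_swap (Pulse_x Plus)"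
  "axis_swap (Pulse_y s) = axis_swap (Pulse_y Plus)"
proof -
  show "axis_swap (Pulse_x s) = axis_swap (Pulse_x Plus)"
  proof
    show "axis_swap (Pulse_x s) \<alpha> = axis_swap (Pulse_x Plus) \<alpha>" for \<alpha>
      by (cases \<alpha>) simp_all
  qed
  show "axis_swap (Pulse_y s) = axis_swap (Pulse_y Plus)"
  proof
    show "axis_swap (Pulse_y s) \<alpha> = axis_swap (Pulse_y Plus) \<alpha>" for \<alpha>
      by (cases \<alpha>) simp_all
  qed
qed

lemma axis_swap_involutive: "axis_swap p (axis_swap p \<alpha>) = \<alpha>"
  by (cases p; cases \<alpha>) simp_all

theorem mainTheorem1:
  fixes J :: "'n::{finite,linorder} \<Rightarrow> 'n \<Rightarrow> real"
    and \<tau> :: real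
    and n :: nat
    and A :: "pulse list"
  assumes "\<tau> > 0"
    and "n \<ge> 1"
    and "block_sequence yxx_block (2 * n) A \<or> block_sequence xyy_block (2 * n) A"
  shows "avg_ham0 (dipolar J Z_axis) \<tau> A = 0 \<and> avg_ham1 (dipolar J Z_axis) \<tau> A = 0"
proof -
  let ?x = "Pulse_x Plus" and ?y = "Pulse_y Plus"
  define f where "f m = dipolar J (toggled_axis A m Z_axis)" for m
  have H: "H_tog (dipolar J Z_axis) \<tau> A = (\<lambda>t. f (nat \<lfloor>t / \<tau>\<rfloor>))"
    by (rule ext) (simp add: H_tog_dipolar f_def)
  \<comment> \<open>Both kinds of blocks are treated at once: \<open>p\<close> stands for the single
    pulse of a block and \<open>q\<close> for the repeated one.\<close>
  obtain p q where pq: "p = ?y \<and> q = ?x \<or> p = ?x \<and> q = ?y" "length A = 6 * n"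
    and swap: "\<And>k. k < 2 * n \<Longrightarrow> axis_swap (A ! (3 * k)) = axis_swap p \<and>
      axis_swap (A ! (3 * k + 1)) = axis_swap q \<and> axis_swap (A ! (3 * k + 2)) = axis_swap q"
    using assms(3)
  proof
    assume bs: "block_sequence yxx_block (2 * n) A"
    have len: "yxx_block B \<Longrightarrow> length B = 3" for B
      by (auto simp: yxx_block_def)
    show ?thesis
    proof (rule that[of ?y ?x])
      fix k assume "k < 2 * n"
      with block_sequence_nth(2)[OF bs len] show "axis_swap (A ! (3 * k)) = axis_swap ?y \<and>
        axis_swap (A ! (3 * k + 1)) = axis_swap ?x \<and> axis_swap (A ! (3 * k + 2)) = axis_swap ?x"
        by (fastforce simp: yxx_block_def intro: axis_swap_eq)
    qed (use block_sequence_nth(1)[OF bs len] in auto)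
  next
    assume bs: "block_sequence xyy_block (2 * n) A"
    have len: "xyy_block B \<Longrightarrow> length B = 3" for B
      by (auto simp: xyy_block_def)
    show ?thesis
    proof (rule that[of ?x ?y])
      fix k assume "k < 2 * n"
      with block_sequence_nth(2)[OF bs len] show "axis_swap (A ! (3 * k)) = axis_swap ?x \<and>
        axis_swap (A ! (3 * k + 1)) = axis_swap ?y \<and> axis_swap (A ! (3 * k + 2)) = axis_swap ?y"
        by (fastforce simp: xyy_block_def intro: axis_swap_eq)
    qed (use block_sequence_nth(1)[OF bs len] in auto)
  qed
  have sum: "dipolar J (axis_swap p Z_axis) + dipolar J (axis_swap q Z_axis) + dipolar J Z_axis = 0"
    using pq(1) sum_dipolar[of J] by (auto simp: add_ac)
  \<comment> \<open>The pulse \<open>q\<close> takes the z axis to the rotation axis of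
    \<open>p\<close>, which \<open>p\<close> fixes. Hence the second and fifth values of a period
    agree.\<close>
  have Z: "axis_swap p (axis_swap q Z_axis) = axis_swap q Z_axis"
    using pq(1) by auto
  have periodic: "f (6 * k) = dipolar J (axis_swap p Z_axis) \<and>
      f (6 * k + 1) = dipolar J (axis_swap q Z_axis) \<and>
      f (6 * k + 2) = dipolar J (axis_swap p Z_axis) \<and> f (6 * k + 3) = dipolar J Z_axis \<and>
      f (6 * k + 4) = dipolar J (axis_swap q Z_axis) \<and> f (6 * k + 5) = dipolar J Z_axis"
    if "k < n" for k
  proof -
    have "toggled_axis A (6 * k) Z_axis = axis_swap p Z_axis \<and>
        toggled_axis A (6 * k + 1) Z_axis = axis_swap p (axis_swap q Z_axis) \<and>
        toggled_axis A (6 * k + 2) Z_axis = axis_swap p Z_axis \<and>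
        toggled_axis A (6 * k + 3) Z_axis = Z_axis \<and>
        toggled_axis A (6 * k + 4) Z_axis = axis_swap q Z_axis \<and>
        toggled_axis A (6 * k + 5) Z_axis = Z_axis"
      by (rule toggled_axis_periodic[OF swap axis_swap_involutive axis_swap_involutive that])
    then show ?thesis
      by (simp only: f_def Z)
  qed
  have sums: "(\<Sum>k<6 * n. f k) = 0" "(\<Sum>m<6 * n. commutator (f m) (\<Sum>k<m. f k)) = 0"
    using period_six_sums[OF sum, of n f] periodic by blast+
  have "integral {0..real (6 * n) * \<tau>} (\<lambda>t. f (nat \<lfloor>t / \<tau>\<rfloor>)) = \<tau> *\<^sub>R (\<Sum>k<6 * n. f k)"
    using nat_floor_divide[OF assms(1)] by (intro step_integral[OF assms(1)]) metis
  then have I0: "integral {0..real (6 * n) * \<tau>} (\<lambda>t. f (nat \<lfloor>t / \<tau>\<rfloor>)) = 0"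
    by (simp only: sums scaleR_zero_right)
  have "integral {0..real (6 * n) * \<tau>} (\<lambda>t1. integral {0..t1} (\<lambda>t2.
      commutator (f (nat \<lfloor>t1 / \<tau>\<rfloor>)) (f (nat \<lfloor>t2 / \<tau>\<rfloor>)))) =
      \<tau> *\<^sub>R (\<Sum>m<6 * n. \<tau> *\<^sub>R commutator (f m) (\<Sum>k<m. f k))"
  \<comment> \<open>The inner integral need only be known strictly between pulse times, where the
    outer index is \<open>m\<close>.\<close>
  proof (rule step_integral[OF assms(1)])
    fix m t assume t: "real m * \<tau> < t" "t < real (Suc m) * \<tau>"
    show "integral {0..t} (\<lambda>t2. commutator (f (nat \<lfloor>t / \<tau>\<rfloor>)) (f (nat \<lfloor>t2 / \<tau>\<rfloor>))) =
        \<tau> *\<^sub>R commutator (f m) (\<Sum>k<m. f k)"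
      unfolding nat_floor_divide[OF assms(1) t] by (rule inner_integral_commutator[OF assms(1) t])
  qed
  then have I1: "integral {0..real (6 * n) * \<tau>} (\<lambda>t1. integral {0..t1} (\<lambda>t2.
      commutator (f (nat \<lfloor>t1 / \<tau>\<rfloor>)) (f (nat \<lfloor>t2 / \<tau>\<rfloor>)))) = 0"
    by (simp only: sums scaleR_sum_right[symmetric] scaleR_zero_right)
  show ?thesis
    unfolding avg_ham0_def avg_ham1_def H pq(2) Let_def I0 I1
    by (simp add: vec_eq_iff)
qed

end
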